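(* Let $x_1,x_2,x_3$ be three nonnegative real numbers. Then: (e) $x_1^4+x_2^4+x_3^4+6x_1^2x_2^2+6x_1^2x_3^2+6x_2^2x_3^2+4x_1^3x_2+4x_2^3x_3+12x_1x_2x_3^2\geq 4x_1x_2^3+4x_1x_3^3+4x_2x_3^3+4x_1^3x_3+12x_1^2x_2x_3+12x_1x_2^2x_3$, or equivalently, $(x_1+x_2-x_3)^4\geq8(x_1x_2^3-x_2^3x_3)$, with equality if and only if $x_2=0$ and $x_1=x_3$; (f) $x_1^4+x_2^4+x_3^4+6x_1^2x_2^2+6x_1^2x_3^2+6x_2^2x_3^2+4x_1x_3^3+4x_2^3x_3+12x_1^2x_2x_3\geq4x_1^3x_2+4x_2x_3^3+4x_1x_2^3+4x_1^3x_3+12x_1x_2x_3^2+12x_1x_2^2x_3$, or equivalently, $(x_3+x_2-x_1)^4\geq8(x_2x_3^3-x_1x_3^3)$, with equality if and only if $x_2=0$ and $x_1=x_3$; (g) $x_1^4+x_2^4+x_3^4+6x_1^2x_2^2+6x_1^2x_3^2+6x_2^2x_3^2+4x_2x_3^3+4x_1^3x_3+12x_1x_2^2x_3\geq 4x_1x_2^3+4x_1x_3^3+4x_1^3x_2+4x_2^3x_3+12x_1^2x_2x_3+12x_1x_2x_3^2$, or equivalently, $(x_1+x_3-x_2)^4\geq8(x_1x_3^3-x_2x_3^3)$, with equality if and only if $x_3=0$ and $x_1=x_2$.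
   Formalization: In (f) the equality condition "x_2=0 and x_1=x_3" is false as printed (x_1=x_3=1, x_2=0 gives 0 > -8) and is replaced by the correct condition "x_3=0 and x_1=x_2". *)

theory Defs
  imports Complex_Main
begin

end

theory Submission
  imports Defs
begin

text \<open>
  All three parts are instances of one inequality in two real variables,
  \<open>(u + b)^4 \<ge> 8 * u * b^3\<close>, where \<open>b\<close> is one of the three numbers and \<open>u\<close> is the difference
  of the other two. It has the flavour of the weighted arithmetic-geometric mean inequality, which
  for nonnegative \<open>u\<close> and \<open>b\<close> gives it with the better constant \<open>256/27\<close>. Here \<open>u\<close> may be negative,
  so the proof is instead an explicit sum of squares (\<open>fourth_power_gap_sum_squares\<close>).
  One of the summands is a positive multiple of \<open>b^4\<close>, so equality forces \<open>b = 0\<close>, and then the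
  gap is \<open>u^4\<close>, so that \<open>u = 0\<close>.

  The long polynomial form of each part is the same gap multiplied out, with the negative monomials
  moved to the right (\<open>expanded_iff_fourth_power_form\<close>).
\<close>

text \<open>
  Writing the gap as \<open>u^4 + 4*u^3*b + 6*u^2*b^2 - 4*u*b^3 + b^4\<close>, the square of
  \<open>u^2 + 2*u*b + k*b^2\<close> absorbs the first two monomials for any \<open>k\<close>. What remains is
  \<open>b^2\<close> times a quadratic form in \<open>u\<close> and \<open>b\<close>, which is positive definite exactly when
  \<open>-1 < k < 2 - sqrt 5\<close>; the value \<open>k = -1/2\<close> is a convenient choice, and completing the square in
  that form gives the last two summands.
\<close>
lemma fourth_power_gap_sum_squares:
  fixes u b :: real
  shows "(u + b)^4 - 8 * u * b^3
    = (u^2 + 2*u*b - b^2/2)^2 + 3 * (b * (u - b/3))^2 + 5/12 * b^4"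
  by (simp add: field_simps power2_eq_square power3_eq_cube power4_eq_xxxx)

lemma fourth_power_ge_8_mult_cube:
  fixes u b :: real
  shows "(u + b)^4 \<ge> 8 * u * b^3"
proof -
  have "0 \<le> (u^2 + 2*u*b - b^2/2)^2 + 3 * (b * (u - b/3))^2 + 5/12 * b^4"
    by simp
  then show ?thesis
    unfolding fourth_power_gap_sum_squares[symmetric] by simp
qed

lemma fourth_power_eq_8_mult_cube_iff:
  fixes u b :: real
  shows "(u + b)^4 = 8 * u * b^3 \<longleftrightarrow> b = 0 \<and> u = 0"
proof
  assume "(u + b)^4 = 8 * u * b^3"
  then have sum_zero: "(u^2 + 2*u*b - b^2/2)^2 + 3 * (b * (u - b/3))^2 + 5/12 * b^4 = 0"
    unfolding fourth_power_gap_sum_squares[symmetric] by simp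
  moreover have "0 \<le> (u^2 + 2*u*b - b^2/2)^2" "0 \<le> 3 * (b * (u - b/3))^2" "0 \<le> b^4"
    by simp_all
  ultimately have "b^4 = 0"
    by linarith
  then have "b = 0" by simp
  with sum_zero show "b = 0 \<and> u = 0" by simp
qed simp

text \<open>
  The shape shared by the three parts: \<open>L\<close> and \<open>R\<close> collect the positive and negative monomials of
  the gap, and \<open>F\<close> and \<open>G\<close> are the two sides of the compact form. Comparing only differences lets
  each form be checked by a single polynomial identity, wherever its monomials stand. The condition
  \<open>p = q\<close> is separate from \<open>u\<close> because the equality case names the two numbers in a fixed order,
  whereas the sign of \<open>u\<close> matters: the gap is not even in \<open>u\<close>.
\<close>
lemma expanded_iff_fourth_power_form:
  fixes p q u b L R F G :: real
  assumes expanded: "L - R = (u + b)^4 - 8 * u * b^3"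
    and compact: "F - G = (u + b)^4 - 8 * u * b^3"
    and zero: "u = 0 \<longleftrightarrow> p = q"
  shows "R \<le> L \<and> (R \<le> L \<longleftrightarrow> G \<le> F) \<and> (L = R \<longleftrightarrow> b = 0 \<and> p = q) \<and> (F = G \<longleftrightarrow> b = 0 \<and> p = q)"
proof -
  have "R \<le> L" "G \<le> F"
    using expanded compact fourth_power_ge_8_mult_cube[of u b] by linarith+
  moreover have "L = R \<longleftrightarrow> b = 0 \<and> p = q"
    using expanded zero fourth_power_eq_8_mult_cube_iff[of u b] by auto
  moreover have "F = G \<longleftrightarrow> b = 0 \<and> p = q"
    using compact zero fourth_power_eq_8_mult_cube_iff[of u b] by auto
  ultimately show ?thesis by blast
qed

theorem theorem3p14:
  fixes x1 x2 x3 :: real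
  assumes "x1 \<ge> 0" and "x2 \<ge> 0" and "x3 \<ge> 0"
  shows "((x1^4 + x2^4 + x3^4 + 6*x1^2*x2^2 + 6*x1^2*x3^2 + 6*x2^2*x3^2 + 4*x1^3*x2 + 4*x2^3*x3 + 12*x1*x2*x3^2
      \<ge> 4*x1*x2^3 + 4*x1*x3^3 + 4*x2*x3^3 + 4*x1^3*x3 + 12*x1^2*x2*x3 + 12*x1*x2^2*x3)
     \<and> ((x1^4 + x2^4 + x3^4 + 6*x1^2*x2^2 + 6*x1^2*x3^2 + 6*x2^2*x3^2 + 4*x1^3*x2 + 4*x2^3*x3 + 12*x1*x2*x3^2
      \<ge> 4*x1*x2^3 + 4*x1*x3^3 + 4*x2*x3^3 + 4*x1^3*x3 + 12*x1^2*x2*x3 + 12*x1*x2^2*x3)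
          \<longleftrightarrow> (x1 + x2 - x3)^4 \<ge> 8*(x1*x2^3 - x2^3*x3))
     \<and> ((x1^4 + x2^4 + x3^4 + 6*x1^2*x2^2 + 6*x1^2*x3^2 + 6*x2^2*x3^2 + 4*x1^3*x2 + 4*x2^3*x3 + 12*x1*x2*x3^2
      = 4*x1*x2^3 + 4*x1*x3^3 + 4*x2*x3^3 + 4*x1^3*x3 + 12*x1^2*x2*x3 + 12*x1*x2^2*x3)
          \<longleftrightarrow> x2 = 0 \<and> x1 = x3)
     \<and> ((x1 + x2 - x3)^4 = 8*(x1*x2^3 - x2^3*x3) \<longleftrightarrow> x2 = 0 \<and> x1 = x3))
   \<and> ((x1^4 + x2^4 + x3^4 + 6*x1^2*x2^2 + 6*x1^2*x3^2 + 6*x2^2*x3^2 + 4*x1*x3^3 + 4*x2^3*x3 + 12*x1^2*x2*x3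
      \<ge> 4*x1^3*x2 + 4*x2*x3^3 + 4*x1*x2^3 + 4*x1^3*x3 + 12*x1*x2*x3^2 + 12*x1*x2^2*x3)
     \<and> ((x1^4 + x2^4 + x3^4 + 6*x1^2*x2^2 + 6*x1^2*x3^2 + 6*x2^2*x3^2 + 4*x1*x3^3 + 4*x2^3*x3 + 12*x1^2*x2*x3
      \<ge> 4*x1^3*x2 + 4*x2*x3^3 + 4*x1*x2^3 + 4*x1^3*x3 + 12*x1*x2*x3^2 + 12*x1*x2^2*x3)
          \<longleftrightarrow> (x3 + x2 - x1)^4 \<ge> 8*(x2*x3^3 - x1*x3^3))
     \<and> ((x1^4 + x2^4 + x3^4 + 6*x1^2*x2^2 + 6*x1^2*x3^2 + 6*x2^2*x3^2 + 4*x1*x3^3 + 4*x2^3*x3 + 12*x1^2*x2*x3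
      = 4*x1^3*x2 + 4*x2*x3^3 + 4*x1*x2^3 + 4*x1^3*x3 + 12*x1*x2*x3^2 + 12*x1*x2^2*x3)
          \<longleftrightarrow> x3 = 0 \<and> x1 = x2)
     \<and> ((x3 + x2 - x1)^4 = 8*(x2*x3^3 - x1*x3^3) \<longleftrightarrow> x3 = 0 \<and> x1 = x2))
   \<and> ((x1^4 + x2^4 + x3^4 + 6*x1^2*x2^2 + 6*x1^2*x3^2 + 6*x2^2*x3^2 + 4*x2*x3^3 + 4*x1^3*x3 + 12*x1*x2^2*x3
      \<ge> 4*x1*x2^3 + 4*x1*x3^3 + 4*x1^3*x2 + 4*x2^3*x3 + 12*x1^2*x2*x3 + 12*x1*x2*x3^2)
     \<and> ((x1^4 + x2^4 + x3^4 + 6*x1^2*x2^2 + 6*x1^2*x3^2 + 6*x2^2*x3^2 + 4*x2*x3^3 + 4*x1^3*x3 + 12*x1*x2^2*x3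
      \<ge> 4*x1*x2^3 + 4*x1*x3^3 + 4*x1^3*x2 + 4*x2^3*x3 + 12*x1^2*x2*x3 + 12*x1*x2*x3^2)
          \<longleftrightarrow> (x1 + x3 - x2)^4 \<ge> 8*(x1*x3^3 - x2*x3^3))
     \<and> ((x1^4 + x2^4 + x3^4 + 6*x1^2*x2^2 + 6*x1^2*x3^2 + 6*x2^2*x3^2 + 4*x2*x3^3 + 4*x1^3*x3 + 12*x1*x2^2*x3
      = 4*x1*x2^3 + 4*x1*x3^3 + 4*x1^3*x2 + 4*x2^3*x3 + 12*x1^2*x2*x3 + 12*x1*x2*x3^2)
          \<longleftrightarrow> x3 = 0 \<and> x1 = x2)
     \<and> ((x1 + x3 - x2)^4 = 8*(x1*x3^3 - x2*x3^3) \<longleftrightarrow> x3 = 0 \<and> x1 = x2))"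
proof -
  note part_e = expanded_iff_fourth_power_form[where u = "x1 - x3" and b = x2]
  note part_f = expanded_iff_fourth_power_form[where u = "x2 - x1" and b = x3]
  note part_g = expanded_iff_fourth_power_form[where u = "x1 - x2" and b = x3]
  show ?thesis
    by (rule conjI[OF part_e conjI[OF part_f part_g]])
      (auto simp: algebra_simps power2_eq_square power3_eq_cube power4_eq_xxxx)
qed

end
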